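(* Let $D$ be an infinite, connected, distance-transitive, weakly descendant-homogeneous digraph of finite out-valency $m>0$ with no directed cycles, and assume that its descendant subdigraph satisfies P3. Then $D$ has infinite in-valency, the reachability relation on the edges of $D$ is universal, and $D$ does not have property $Z$.
   Context: Digraphs have no loops; subdigraphs are induced. An $s$-arc ($s\ge0$) from $u$ to $v$ is a sequence $u_0\dots u_s$ with $u_0=u$, $u_s=v$, $(u_i,u_{i+1})$ edges, and $u_{i-1}\ne u_{i+1}$ for $0<i<s$. $D^s(u)$ is the set of vertices reachable from $u$ by an $s$-arc, $\mathrm{desc}(u)=\bigcup_{s\ge0}D^s(u)$, $\mathrm{desc}(X)=\bigcup_{x\in X}\mathrm{desc}(x)$. Distance-transitive: for each $s\ge0$, $\mathrm{Aut}(D)$ is transitive on pairs $(u,v)$ with an $s$-arc but no shorter arc from $u$ to $v$. Weakly descendant-homogeneous: $D$ is vertex transitive and for finite vertex sets $X,Y$ and any isomorphism $f$ between the induced subdigraphs on $\mathrm{desc}(X)$ and $\mathrm{desc}(Y)$ there is an automorphism of $D$ agreeing with $f$ on $X$. A directed cycle is $u_0,\dots,u_n=u_0$ ($n\ge1$) with consecutive edges. The descendant subdigraph $\Gamma=\Gamma(\alpha)$ is the induced subdigraph on $\mathrm{desc}(\alpha)$ and $\Gamma^i(\alpha)=D^i(\alpha)$; P3: $|\Gamma^i(\alpha)|<|\Gamma^{i+1}(\alpha)|$ for all integers $i\ge1$. Property $Z$: there is a surjection $f$ from vertices onto $\mathbb{Z}$ with $f(v)=f(u)+1$ for each edge $(u,v)$.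 Alternating walk: $x_0\dots x_n$ such that either $(x_{2i-1},x_{2i})$ and $(x_{2i+1},x_{2i})$ are edges for all relevant $i$, or $(x_{2i},x_{2i-1})$ and $(x_{2i},x_{2i+1})$ are edges for all relevant $i$. Edge $e$ reaches edge $e'$ if there is an alternating walk $x_0\dots x_n$ with $e=(x_0,x_1)$ and $e'\in\{(x_{n-1},x_n),(x_n,x_{n-1})\}$; the reachability relation is universal if it has one class. *)

theory Defs
  imports "Graph_Theory.Graph_Theory"
begin

(* A walk u_0 ... u_s is encoded by a function on nat of which only the values at 0..s matter. *)

definition s_arc :: "'a pair_pre_digraph \<Rightarrow> nat \<Rightarrow> (nat \<Rightarrow> 'a) \<Rightarrow> 'a \<Rightarrow> 'a \<Rightarrow> bool" where
  "s_arc D s p u v \<longleftrightarrow>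
     p 0 = u \<and> p s = v \<and> (\<forall>i\<le>s. p i \<in> pverts D) \<and>
     (\<forall>i<s. (p i, p (i + 1)) \<in> parcs D) \<and>
     (\<forall>i. 0 < i \<and> i < s \<longrightarrow> p (i - 1) \<noteq> p (i + 1))"

definition desc_level :: "'a pair_pre_digraph \<Rightarrow> nat \<Rightarrow> 'a \<Rightarrow> 'a set" where
  "desc_level D s u = {v. \<exists>p. s_arc D s p u v}"

definition desc :: "'a pair_pre_digraph \<Rightarrow> 'a \<Rightarrow> 'a set" where
  "desc D u = (\<Union>s. desc_level D s u)"

definition desc_set :: "'a pair_pre_digraph \<Rightarrow> 'a set \<Rightarrow> 'a set" where
  "desc_set D X = (\<Union>x\<in>X. desc D x)"

(* There are no parallel arcs, so an isomorphism is determined by its vertex map; its values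
   outside the vertex set of the domain are irrelevant. *)

definition digraph_isom :: "('a \<Rightarrow> 'b) \<Rightarrow> ('a, 'a \<times> 'a) pre_digraph \<Rightarrow> ('b, 'b \<times> 'b) pre_digraph \<Rightarrow> bool" where
  "digraph_isom f G H \<longleftrightarrow>
     bij_betw f (verts G) (verts H) \<and>
     (\<forall>u\<in>verts G. \<forall>v\<in>verts G. u \<rightarrow>\<^bsub>G\<^esub> v \<longleftrightarrow> f u \<rightarrow>\<^bsub>H\<^esub> f v)"

definition digraph_aut :: "'a pair_pre_digraph \<Rightarrow> ('a \<Rightarrow> 'a) \<Rightarrow> bool" where
  "digraph_aut D g \<longleftrightarrow> digraph_isom g (with_proj D) (with_proj D)"

definition vertex_transitive :: "'a pair_pre_digraph \<Rightarrow> bool" where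
  "vertex_transitive D \<longleftrightarrow>
     (\<forall>u\<in>pverts D. \<forall>v\<in>pverts D. \<exists>g. digraph_aut D g \<and> g u = v)"

definition at_distance :: "'a pair_pre_digraph \<Rightarrow> nat \<Rightarrow> 'a \<Rightarrow> 'a \<Rightarrow> bool" where
  "at_distance D s u v \<longleftrightarrow>
     (\<exists>p. s_arc D s p u v) \<and> (\<forall>t<s. \<nexists>p. s_arc D t p u v)"

definition distance_transitive :: "'a pair_pre_digraph \<Rightarrow> bool" where
  "distance_transitive D \<longleftrightarrow>
     (\<forall>s u v u' v'. at_distance D s u v \<and> at_distance D s u' v' \<longrightarrow>
        (\<exists>g. digraph_aut D g \<and> g u = u' \<and> g v = v'))"

definition weakly_descendant_homogeneous :: "'a pair_pre_digraph \<Rightarrow> bool" where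
  "weakly_descendant_homogeneous D \<longleftrightarrow>
     vertex_transitive D \<and>
     (\<forall>X Y f. X \<subseteq> pverts D \<and> finite X \<and> Y \<subseteq> pverts D \<and> finite Y \<and>
        digraph_isom f (with_proj D \<restriction> desc_set D X) (with_proj D \<restriction> desc_set D Y) \<longrightarrow>
        (\<exists>g. digraph_aut D g \<and> (\<forall>x\<in>X. g x = f x)))"

definition has_out_valency :: "'a pair_pre_digraph \<Rightarrow> nat \<Rightarrow> bool" where
  "has_out_valency D m \<longleftrightarrow>
     (\<forall>v\<in>pverts D. finite (out_arcs D v) \<and> out_degree D v = m)"

definition infinite_in_valency :: "'a pair_pre_digraph \<Rightarrow> bool" where
  "infinite_in_valency D \<longleftrightarrow> (\<forall>v\<in>pverts D. infinite (in_arcs D v))"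

definition directed_cycle :: "'a pair_pre_digraph \<Rightarrow> nat \<Rightarrow> (nat \<Rightarrow> 'a) \<Rightarrow> bool" where
  "directed_cycle D n p \<longleftrightarrow> n \<ge> 1 \<and> p n = p 0 \<and> (\<forall>i<n. (p i, p (i + 1)) \<in> parcs D)"

(* Only used for digraphs of finite out-valency, where all the levels are finite sets. *)

definition descendants_P3 :: "'a pair_pre_digraph \<Rightarrow> bool" where
  "descendants_P3 D \<longleftrightarrow>
     (\<forall>\<alpha>\<in>pverts D. \<forall>i\<ge>1. card (desc_level D i \<alpha>) < card (desc_level D (i + 1) \<alpha>))"

definition property_Z :: "'a pair_pre_digraph \<Rightarrow> bool" where
  "property_Z D \<longleftrightarrow>
     (\<exists>f :: 'a \<Rightarrow> int. f ` pverts D = UNIV \<and> (\<forall>(u, v)\<in>parcs D. f v = f u + 1))"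

definition alternating_walk :: "'a pair_pre_digraph \<Rightarrow> nat \<Rightarrow> (nat \<Rightarrow> 'a) \<Rightarrow> bool" where
  "alternating_walk D n x \<longleftrightarrow>
     (\<forall>i\<le>n. x i \<in> pverts D) \<and>
     ((\<forall>i. 1 \<le> i \<and> 2 * i \<le> n \<longrightarrow> (x (2 * i - 1), x (2 * i)) \<in> parcs D) \<and>
      (\<forall>i. 2 * i + 1 \<le> n \<longrightarrow> (x (2 * i + 1), x (2 * i)) \<in> parcs D)
      \<or>
      (\<forall>i. 1 \<le> i \<and> 2 * i \<le> n \<longrightarrow> (x (2 * i), x (2 * i - 1)) \<in> parcs D) \<and>
      (\<forall>i. 2 * i + 1 \<le> n \<longrightarrow> (x (2 * i), x (2 * i + 1)) \<in> parcs D))"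

definition edge_reachability :: "'a pair_pre_digraph \<Rightarrow> ('a \<times> 'a) rel" where
  "edge_reachability D =
     {(e, e'). e \<in> parcs D \<and> e' \<in> parcs D \<and>
        (\<exists>n x. n \<ge> 1 \<and> alternating_walk D n x \<and> e = (x 0, x 1) \<and>
           e' \<in> {(x (n - 1), x n), (x n, x (n - 1))})}"

definition reachability_universal :: "'a pair_pre_digraph \<Rightarrow> bool" where
  "reachability_universal D \<longleftrightarrow> card (parcs D // edge_reachability D) = 1"

end

theory Submission
  imports Defs
begin

text \<open>
  Distance-transitivity forces the levels below a vertex \<open>u\<close> to be disjoint. The number of
  predecessors that a vertex of level \<open>j + 1\<close> has inside level \<open>j\<close> depends only on \<open>j\<close>, does not
  decrease with \<open>j\<close>, and is bounded by \<open>m\<close> because the levels grow; hence it stabilises. From this,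
  P3 yields two out-neighbours of one vertex without common descendants. By weak
  descendant-homogeneity any two vertices without common descendants are then out-neighbours of one
  vertex. If \<open>x\<close> and \<open>y\<close> have no common descendant, neither have \<open>x\<close> and any descendant \<open>z\<close> of \<open>y\<close>,
  so \<open>x\<close> shares a predecessor with each of them: there are infinitely many such \<open>z\<close>, a height
  function would give \<open>x\<close>, \<open>y\<close> and \<open>z\<close> the same height, and every edge into \<open>y\<close> reaches every edge
  out of \<open>y\<close>.
\<close>

section \<open>Automorphisms of a relation on a carrier set\<close>

definition rel_aut :: "'a set \<Rightarrow> 'a rel \<Rightarrow> ('a \<Rightarrow> 'a) \<Rightarrow> bool" where
  "rel_aut V E g \<longleftrightarrow> bij_betw g V V \<and> (\<forall>u\<in>V. \<forall>v\<in>V. (u, v) \<in> E \<longleftrightarrow> (g u, g v) \<in> E)"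

lemma rel_aut_in: "rel_aut V E g \<Longrightarrow> u \<in> V \<Longrightarrow> g u \<in> V"
  by (auto simp: rel_aut_def bij_betw_def)

lemma rel_aut_inv:
  assumes "rel_aut V E g"
  shows "rel_aut V E (inv_into V g)"
proof -
  have b: "bij_betw g V V" using assms by (simp add: rel_aut_def)
  have "(u, v) \<in> E \<longleftrightarrow> (inv_into V g u, inv_into V g v) \<in> E" if "u \<in> V" "v \<in> V" for u v
  proof -
    have "inv_into V g u \<in> V" "inv_into V g v \<in> V"
      using b that by (auto simp: bij_betw_def inv_into_into)
    moreover have "g (inv_into V g u) = u" "g (inv_into V g v) = v"
      using b that by (auto simp: bij_betw_inv_into_right)
    ultimately show ?thesis using assms unfolding rel_aut_def by metis
  qed
  then show ?thesis using b by (simp add: rel_aut_def bij_betw_inv_into)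
qed

lemma relpow_in_carrier:
  assumes "E \<subseteq> V \<times> V" "(u, v) \<in> E ^^ n" "u \<in> V"
  shows "v \<in> V"
  using assms(2,3) by (induction n arbitrary: v) (use assms(1) in auto)

lemma rel_aut_relpow:
  assumes "E \<subseteq> V \<times> V" "rel_aut V E g" "(u, v) \<in> E ^^ n"
  shows "(g u, g v) \<in> E ^^ n"
  using assms(3)
proof (induction n arbitrary: v)
  case (Suc n)
  then obtain w where w: "(u, w) \<in> E ^^ n" "(w, v) \<in> E" by auto
  then have "(g w, g v) \<in> E" using assms(1,2) unfolding rel_aut_def by blast
  with Suc.IH[OF w(1)] show ?case by auto
qed simp

lemma rel_aut_relpow_iff:
  assumes "E \<subseteq> V \<times> V" "rel_aut V E g" "u \<in> V" "v \<in> V"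
  shows "(g u, g v) \<in> E ^^ n \<longleftrightarrow> (u, v) \<in> E ^^ n"
proof
  assume "(g u, g v) \<in> E ^^ n"
  from rel_aut_relpow[OF assms(1) rel_aut_inv[OF assms(2)] this]
  show "(u, v) \<in> E ^^ n"
    using assms(2-4) bij_betw_inv_into_left[of g V V] by (simp add: rel_aut_def)
qed (rule rel_aut_relpow[OF assms(1,2)])

lemma rel_aut_image_relpow:
  assumes "E \<subseteq> V \<times> V" "rel_aut V E g" "u \<in> V"
  shows "bij_betw g ((E ^^ n) `` {u}) ((E ^^ n) `` {g u})"
  unfolding bij_betw_def
proof
  have b: "bij_betw g V V" using assms by (simp add: rel_aut_def)
  have sub: "(E ^^ n) `` {u} \<subseteq> V" using relpow_in_carrier[OF assms(1)] assms(3) by auto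
  then show "inj_on g ((E ^^ n) `` {u})"
    using b by (meson bij_betw_def inj_on_subset)
  show "g ` ((E ^^ n) `` {u}) = (E ^^ n) `` {g u}"
  proof
    show "g ` ((E ^^ n) `` {u}) \<subseteq> (E ^^ n) `` {g u}"
      using rel_aut_relpow[OF assms(1,2)] by auto
    show "(E ^^ n) `` {g u} \<subseteq> g ` ((E ^^ n) `` {u})"
    proof
      fix w assume w: "w \<in> (E ^^ n) `` {g u}"
      then have "w \<in> V"
        using relpow_in_carrier[OF assms(1), of "g u" w n] rel_aut_in[OF assms(2,3)] by auto
      then obtain v where "v \<in> V" "w = g v" using b by (auto simp: bij_betw_def)
      then show "w \<in> g ` ((E ^^ n) `` {u})"
        using w rel_aut_relpow_iff[OF assms] by auto
    qed
  qed
qed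

lemma rel_aut_image_rtrancl:
  assumes "E \<subseteq> V \<times> V" "rel_aut V E g" "u \<in> V"
  shows "bij_betw g (E\<^sup>* `` {u}) (E\<^sup>* `` {g u})"
proof -
  have eq: "E\<^sup>* `` {w} = (\<Union>n. (E ^^ n) `` {w})" for w
    by (auto simp: rtrancl_is_UN_relpow)
  have im: "g ` ((E ^^ n) `` {u}) = (E ^^ n) `` {g u}" for n
    using rel_aut_image_relpow[OF assms] by (simp add: bij_betw_def)
  have "E\<^sup>* `` {u} \<subseteq> V"
    using relpow_in_carrier[OF assms(1)] assms(3) by (auto simp: eq)
  moreover have "inj_on g V" using assms(2) by (simp add: rel_aut_def bij_betw_def)
  ultimately show ?thesis
    by (auto simp: bij_betw_def eq image_UN im intro: inj_on_subset)
qed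

text \<open>The maximum over indices \<ge> 1 is attained at some \<open>K\<close>, and monotonicity
  keeps the sequence there. The bound starts at index 1 because P3 compares levels only from 1
  on.\<close>

lemma bounded_mono_nat_stabilises:
  fixes d :: "nat \<Rightarrow> nat"
  assumes mono: "\<And>j. d j \<le> d (Suc j)" and bound: "\<And>j. j \<ge> 1 \<Longrightarrow> d j \<le> m"
  obtains K where "K \<ge> 1" "\<And>j. j \<ge> K \<Longrightarrow> d j = d K"
proof -
  have fin: "finite (d ` {1..})" by (rule finite_subset[of _ "{..m}"]) (use bound in auto)
  then have "Max (d ` {1..}) \<in> d ` {1..}" by (intro Max_in) auto
  then obtain K where K: "K \<ge> 1" "d K = Max (d ` {1..})" by auto
  have "d j = d K" if "j \<ge> K" for j
  proof (rule antisym)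
    show "d j \<le> d K" using K that fin by (auto intro!: Max_ge)
    show "d K \<le> d j" using lift_Suc_mono_le[of d, OF mono that] .
  qed
  with K(1) show ?thesis by (rule that)
qed

text \<open>Without directed cycles an s-arc is just a directed walk of length \<open>s\<close>, so
  levels are images under the powers \<open>E ^^ s\<close>. \<open>dist_trans\<close> is
  distance-transitivity with \<open>s\<close> the length of a shortest walk; \<open>growth\<close>
  is P3.\<close>

locale distance_transitive_dag =
  fixes V :: "'a set" and E :: "'a rel" and m :: nat
  assumes arcs_subset: "E \<subseteq> V \<times> V"
    and acyclic_arcs: "acyclic E"
    and finite_out: "u \<in> V \<Longrightarrow> finite (E `` {u})"
    and card_out: "u \<in> V \<Longrightarrow> card (E `` {u}) = m"
    and out_pos: "m > 0"
    and vertex_trans: "\<lbrakk>u \<in> V; v \<in> V\<rbrakk> \<Longrightarrow> \<exists>g. rel_aut V E g \<and> g u = v"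
    and dist_trans: "\<lbrakk>u \<in> V; u' \<in> V; (u, v) \<in> E ^^ s; \<And>t. t < s \<Longrightarrow> (u, v) \<notin> E ^^ t;
        (u', v') \<in> E ^^ s; \<And>t. t < s \<Longrightarrow> (u', v') \<notin> E ^^ t\<rbrakk>
        \<Longrightarrow> \<exists>g. rel_aut V E g \<and> g u = u' \<and> g v = v'"
    and growth: "\<lbrakk>u \<in> V; i \<ge> 1\<rbrakk> \<Longrightarrow> card ((E ^^ i) `` {u}) < card ((E ^^ Suc i) `` {u})"
begin

section \<open>Levels of descendants and their disjointness\<close>

lemma out_nonempty: "u \<in> V \<Longrightarrow> \<exists>v. (u, v) \<in> E"
  using card_out[of u] out_pos by (cases "E `` {u} = {}") auto

lemmas relpow_in = relpow_in_carrier[OF arcs_subset]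

lemma finite_level: "u \<in> V \<Longrightarrow> finite ((E ^^ n) `` {u})"
proof (induction n)
  case (Suc n)
  have "(E ^^ Suc n) `` {u} = (\<Union>v\<in>(E ^^ n) `` {u}. E `` {v})" by auto
  then show ?case using Suc finite_out relpow_in by auto
qed simp

lemma level_nonempty: "u \<in> V \<Longrightarrow> \<exists>v. (u, v) \<in> E ^^ n"
proof (induction n)
  case (Suc n)
  then obtain v where "(u, v) \<in> E ^^ n" by auto
  then show ?case using out_nonempty[OF relpow_in] Suc.prems by (meson relpow_Suc_I)
qed auto

text \<open>P3 adds at least one vertex per level from level 1 on; level 1 itself is nonempty
  because \<open>m > 0\<close>. This makes descendant sets infinite.\<close>

lemma card_level_ge: "u \<in> V \<Longrightarrow> n \<le> card ((E ^^ n) `` {u})"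
proof (induction n)
  case (Suc n)
  show ?case
  proof (cases "n = 0")
    case True
    then show ?thesis using card_out[OF Suc.prems] out_pos by simp
  next
    case False
    then show ?thesis using growth[OF Suc.prems, of n] Suc by simp
  qed
qed simp

lemma infinite_descendants: 
  assumes "u \<in> V"
  shows "infinite (E\<^sup>* `` {u})"
proof
  assume fin: "finite (E\<^sup>* `` {u})"
  let ?n = "Suc (card (E\<^sup>* `` {u}))"
  have "card ((E ^^ ?n) `` {u}) \<le> card (E\<^sup>* `` {u})"
    using fin by (intro card_mono) (auto simp del: relpow.simps dest: relpow_imp_rtrancl)
  with card_level_ge[OF assms, of ?n] show False by simp
qed

text \<open>An acyclic relation on a finite set is well-founded, and a minimal element of
  \<open>L\<close> has no proper ancestor in \<open>L\<close>.\<close>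

lemma no_ancestor_closed_finite_set:
  assumes "finite L" "L \<noteq> {}" "\<And>w. w \<in> L \<Longrightarrow> \<exists>w'\<in>L. (w', w) \<in> E\<^sup>+"
  shows False
proof -
  have "acyclic (E\<^sup>+)" using acyclic_arcs by (simp add: acyclic_def)
  then have "acyclic (E\<^sup>+ \<inter> L \<times> L)" by (rule acyclic_subset) auto
  then have "wf (E\<^sup>+ \<inter> L \<times> L)" using assms(1) by (intro finite_acyclic_wf) auto
  then obtain z where "z \<in> L" "\<And>y. (y, z) \<in> E\<^sup>+ \<inter> L \<times> L \<Longrightarrow> y \<notin> L"
    using assms(2) by (metis wf_eq_minimal all_not_in_conv)
  with assms(3) show False by blast
qed

text \<open>
  For a shortest pair of directed paths of different lengths with the same ends, transitivity
  provides every vertex of the finite level \<open>t - 1\<close> with a proper ancestor in that same level.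
\<close>

lemma levels_disjoint_less:
  assumes "u \<in> V" "(u, v) \<in> E ^^ s" "(u, v) \<in> E ^^ t" "s < t"
  shows False
  using assms
proof (induction t arbitrary: u v s rule: less_induct)
  case (less t)
  \<comment> \<open>Distance-transitivity speaks of shortest walks only, so \<open>s\<close> is
    replaced by the distance \<open>r\<close> from \<open>u\<close> to \<open>v\<close>.\<close>
  define r where "r = (LEAST s. (u, v) \<in> E ^^ s)"
  have r: "(u, v) \<in> E ^^ r" "\<And>s. s < r \<Longrightarrow> (u, v) \<notin> E ^^ s"
    using LeastI[of "\<lambda>s. (u, v) \<in> E ^^ s", OF less.prems(2)] not_less_Least
    by (auto simp: r_def)
  have "r \<le> s" using less.prems(2) by (simp add: r_def Least_le)
  with less.prems(4) have "r < t" by simp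
  then obtain q where q: "t = Suc q" "r \<le> q" by (cases t) auto
  let ?L = "(E ^^ q) `` {u}"
  have "\<exists>w'\<in>?L. (w', w) \<in> E\<^sup>+" if "w \<in> ?L" for w
  proof -
    have "(u, w) \<in> E ^^ (r + (q - r))" using that q(2) by simp
    then obtain x where x: "(u, x) \<in> E ^^ r" "(x, w) \<in> E ^^ (q - r)"
      unfolding relpow_add by auto
    \<comment> \<open>\<open>x\<close> is the vertex at step \<open>r\<close> on a walk from
      \<open>u\<close> to \<open>w\<close>. A shorter walk to \<open>x\<close> would be a
      counterexample with \<open>r < t\<close> as the larger length, which the induction hypothesis
      excludes.\<close>
    have "(u, x) \<notin> E ^^ s" if "s < r" for s
      using less.IH[OF \<open>r < t\<close> less.prems(1) _ x(1) that] by blast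
    with dist_trans[OF less.prems(1) less.prems(1) r x(1)]
    obtain g where g: "rel_aut V E g" "g u = u" "g v = x" by blast
    \<comment> \<open>The automorphism carries the long walk to \<open>v\<close> onto one to
      \<open>x\<close>; its last vertex before \<open>x\<close> lies in level \<open>q\<close> and
      is a proper ancestor of \<open>w\<close>.\<close>
    have "(u, x) \<in> E ^^ t"
      using rel_aut_relpow[OF arcs_subset g(1) less.prems(3)] g by simp
    then obtain w' where "(u, w') \<in> E ^^ q" "(w', x) \<in> E" using q by auto
    then show ?thesis
      using rtrancl_into_trancl2[OF _ relpow_imp_rtrancl[OF x(2)]] by blast
  qed
  then show False
    using no_ancestor_closed_finite_set[of ?L] finite_level level_nonempty less.prems(1) by blast
qed

lemma level_unique:
  assumes "u \<in> V" "(u, v) \<in> E ^^ s" "(u, v) \<in> E ^^ t"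
  shows "s = t"
  using levels_disjoint_less[OF assms(1)] assms(2,3) by (meson linorder_neqE_nat)

text \<open>Since levels are disjoint, every walk from \<open>u\<close> to \<open>v\<close> is a
  shortest one, so the minimality premises of \<open>dist_trans\<close> are automatic.\<close>

lemma transitive_on_levels:
  assumes "u \<in> V" "u' \<in> V" "(u, v) \<in> E ^^ s" "(u', v') \<in> E ^^ s"
  shows "\<exists>g. rel_aut V E g \<and> g u = u' \<and> g v = v'"
  using assms levels_disjoint_less by (intro dist_trans[where s = s]) blast+

lemma card_level_eq:
  assumes "u \<in> V" "v \<in> V"
  shows "card ((E ^^ n) `` {u}) = card ((E ^^ n) `` {v})"
  using vertex_trans[OF assms] rel_aut_image_relpow[OF arcs_subset _ assms(1)] bij_betw_same_card
  by metis

section \<open>In-degrees between consecutive levels\<close>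

definition level_preds :: "nat \<Rightarrow> 'a \<Rightarrow> 'a \<Rightarrow> 'a set" where
  "level_preds j u v = {p \<in> (E ^^ j) `` {u}. (p, v) \<in> E}"

lemma finite_level_preds: "u \<in> V \<Longrightarrow> finite (level_preds j u v)"
  unfolding level_preds_def by (rule finite_subset[OF _ finite_level]) auto

text \<open>An automorphism taking \<open>(u, v)\<close> to \<open>(u', v')\<close> preserves both
  the level and the arcs into \<open>v\<close>, so it maps one predecessor set onto the
  other.\<close>

lemma card_level_preds_eq:
  assumes "u \<in> V" "u' \<in> V" "(u, v) \<in> E ^^ Suc j" "(u', v') \<in> E ^^ Suc j"
  shows "card (level_preds j u v) = card (level_preds j u' v')"
proof -
  obtain g where g: "rel_aut V E g" "g u = u'" "g v = v'"
    using transitive_on_levels[OF assms] by blast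
  have v: "v \<in> V" using relpow_in[OF assms(3,1)] .
  have b: "bij_betw g ((E ^^ j) `` {u}) ((E ^^ j) `` {u'})"
    using rel_aut_image_relpow[OF arcs_subset g(1) assms(1)] g by simp
  have sub: "(E ^^ j) `` {u} \<subseteq> V" using relpow_in assms(1) by auto
  have e: "(g p, v') \<in> E \<longleftrightarrow> (p, v) \<in> E" if "p \<in> V" for p
    using g v that unfolding rel_aut_def by blast
  have "g ` level_preds j u v = level_preds j u' v'"
  proof
    show "g ` level_preds j u v \<subseteq> level_preds j u' v'"
      using b sub e unfolding level_preds_def bij_betw_def by blast
    show "level_preds j u' v' \<subseteq> g ` level_preds j u v"
    proof
      fix q assume q: "q \<in> level_preds j u' v'"
      then obtain p where "p \<in> (E ^^ j) `` {u}" "q = g p"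
        using b unfolding level_preds_def bij_betw_def by blast
      with q e sub show "q \<in> g ` level_preds j u v" unfolding level_preds_def by blast
    qed
  qed
  moreover have "inj_on g (level_preds j u v)"
    using b unfolding level_preds_def bij_betw_def by (auto intro: inj_on_subset)
  ultimately have "bij_betw g (level_preds j u v) (level_preds j u' v')"
    by (simp add: bij_betw_def)
  then show ?thesis by (rule bij_betw_same_card)
qed

text \<open>The choice picks the common value, which by \<open>card_level_preds_eq\<close> does not
  depend on \<open>u\<close> and \<open>v\<close>.\<close>

definition level_in_degree :: "nat \<Rightarrow> nat" where
  "level_in_degree j =
     (SOME d. \<forall>u\<in>V. \<forall>v. (u, v) \<in> E ^^ Suc j \<longrightarrow> card (level_preds j u v) = d)"

lemma card_level_preds:
  assumes "u \<in> V" "(u, v) \<in> E ^^ Suc j"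
  shows "card (level_preds j u v) = level_in_degree j"
proof -
  have "\<exists>d. \<forall>u\<in>V. \<forall>v. (u, v) \<in> E ^^ Suc j \<longrightarrow> card (level_preds j u v) = d"
    using card_level_preds_eq[OF _ assms(1) _ assms(2)] by blast
  from someI_ex[OF this] show ?thesis using assms unfolding level_in_degree_def by blast
qed

text \<open>Prefixing the arc \<open>(u, w)\<close> turns a walk from \<open>w\<close> into one from
  \<open>u\<close> that is longer by one. Hence in-degrees cannot decrease with depth.\<close>

lemma level_preds_mono:
  assumes "(u, w) \<in> E"
  shows "level_preds j w v \<subseteq> level_preds (Suc j) u v"
proof
  fix p assume "p \<in> level_preds j w v"
  then show "p \<in> level_preds (Suc j) u v"
    using relpow_Suc_I2[OF assms, of p j] by (simp add: level_preds_def del: relpow.simps)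
qed

lemma level_in_degree_mono:
  assumes "V \<noteq> {}"
  shows "level_in_degree j \<le> level_in_degree (Suc j)"
proof -
  obtain u w where uw: "u \<in> V" "(u, w) \<in> E" using assms out_nonempty by blast
  then have w: "w \<in> V" using arcs_subset by auto
  obtain v where v: "(w, v) \<in> E ^^ Suc j" using level_nonempty[OF w] by blast
  have "card (level_preds j w v) \<le> card (level_preds (Suc j) u v)"
    using uw by (intro card_mono finite_level_preds level_preds_mono)
  then show ?thesis
    using card_level_preds[OF w v] card_level_preds[OF uw(1) relpow_Suc_I2[OF uw(2) v]] by simp
qed

text \<open>Count the arcs between levels \<open>j\<close> and \<open>j + 1\<close> from both sides:
  \<open>card S * m = level_in_degree j * card T\<close>. As \<open>card S < card T\<close> by P3,
  the in-degree cannot exceed \<open>m\<close>.\<close>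

lemma level_in_degree_le:
  assumes "V \<noteq> {}" "j \<ge> 1"
  shows "level_in_degree j \<le> m"
proof -
  obtain u where u: "u \<in> V" using assms by blast
  define S T where "S = (E ^^ j) `` {u}" and "T = (E ^^ Suc j) `` {u}"
  have SV: "S \<subseteq> V" using relpow_in u by (auto simp: S_def)
  have lt: "card S < card T" using growth[OF u assms(2)] by (simp only: S_def T_def)
  have "(\<Sum>p\<in>S. card {v \<in> T. (p, v) \<in> E}) = level_in_degree j * card T"
  proof (rule sum_multicount)
    show "\<forall>v\<in>T. card {p \<in> S. (p, v) \<in> E} = level_in_degree j"
      using card_level_preds[OF u, unfolded level_preds_def] unfolding S_def T_def by blast
    show "finite S" "finite T" unfolding S_def T_def by (rule finite_level[OF u])+
  qed
  \<comment> \<open>Every out-neighbour of a vertex of \<open>S\<close> lies in \<open>T\<close>, so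
    each vertex of \<open>S\<close> contributes \<open>m\<close> to the sum.\<close>
  moreover have "{v \<in> T. (p, v) \<in> E} = E `` {p}" if "p \<in> S" for p
    using that by (auto simp: S_def T_def)
  ultimately have "card S * m = level_in_degree j * card T"
    using card_out SV by (simp add: subset_iff)
  then have "level_in_degree j * card T \<le> m * card T"
    using lt by (metis less_imp_le mult.commute mult_le_mono1)
  then show ?thesis using lt by simp
qed

text \<open>Once in-degrees are stable, a vertex deep below \<open>w\<close> has no more
  predecessors in the levels of \<open>u\<close> than in those of \<open>w\<close>. So any walk from
  \<open>y\<close> to \<open>x\<close>, followed upwards from \<open>x\<close>, stays among the
  descendants of \<open>w\<close>.\<close>

lemma ancestors_stay_below:
  assumes K: "\<And>j. j \<ge> K \<Longrightarrow> level_in_degree j = level_in_degree K"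
    and uw: "u \<in> V" "(u, w) \<in> E"
    and "(w, x) \<in> E ^^ (K + j)" "(u, y) \<in> E ^^ Suc K" "(y, x) \<in> E ^^ j"
  shows "(w, y) \<in> E ^^ K"
  using assms(4-6)
proof (induction j arbitrary: x)
  case (Suc j)
  have w: "w \<in> V" using uw arcs_subset by auto
  obtain p where p: "(y, p) \<in> E ^^ j" "(p, x) \<in> E" using Suc.prems(3) by auto
  have wx: "(w, x) \<in> E ^^ Suc (K + j)" using Suc.prems(1) by simp
  \<comment> \<open>One set contains the other, and by stability both have
    \<open>level_in_degree K\<close> elements.\<close>
  have "level_preds (K + j) w x = level_preds (Suc (K + j)) u x"
  proof (rule card_subset_eq)
    show "card (level_preds (K + j) w x) = card (level_preds (Suc (K + j)) u x)"
      using card_level_preds[OF w wx] card_level_preds[OF uw(1) relpow_Suc_I2[OF uw(2) wx]]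
        K[of "K + j"] K[of "Suc (K + j)"] by simp
  qed (use uw finite_level_preds level_preds_mono in auto)
  moreover have "(u, p) \<in> E ^^ (Suc K + j)"
    using Suc.prems(2) p(1) unfolding relpow_add by blast
  then have "p \<in> level_preds (Suc (K + j)) u x"
    using p(2) by (simp add: level_preds_def del: relpow.simps)
  ultimately have "p \<in> level_preds (K + j) w x" by blast
  then have "(w, p) \<in> E ^^ (K + j)" by (simp add: level_preds_def)
  from Suc.IH[OF this Suc.prems(2) p(1)] show ?case .
qed simp

section \<open>Siblings without common descendants\<close>

abbreviation meet :: "'a rel" where
  "meet \<equiv> {(x, y). E\<^sup>* `` {x} \<inter> E\<^sup>* `` {y} \<noteq> {}}"

text \<open>A chain of meeting vertices in level \<open>n\<close> lifts to level
  \<open>n + 1\<close>: if \<open>c\<close> and \<open>d\<close> meet below, then so do suitable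
  children of theirs, and the children of a single vertex meet by \<open>sib\<close>.\<close>

lemma level_chain_connected:
  assumes sib: "\<And>p x y. (p, x) \<in> E \<Longrightarrow> (p, y) \<in> E \<Longrightarrow> (x, y) \<in> meet"
    and u: "u \<in> V"
    and "(u, x) \<in> E ^^ n" "(u, y) \<in> E ^^ n"
  shows "(x, y) \<in> (meet \<inter> ((E ^^ n) `` {u}) \<times> ((E ^^ n) `` {u}))\<^sup>*"
  using assms(3,4)
proof (induction n arbitrary: x y)
  case (Suc n)
  let ?L = "(E ^^ n) `` {u}" and ?L' = "(E ^^ Suc n) `` {u}"
  let ?M = "meet \<inter> ?L \<times> ?L" and ?M' = "meet \<inter> ?L' \<times> ?L'"
  obtain a b where a: "(u, a) \<in> E ^^ n" "(a, x) \<in> E" and b: "(u, b) \<in> E ^^ n" "(b, y) \<in> E"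
    using Suc.prems by auto
  have child: "c' \<in> ?L'" if "c \<in> ?L" "(c, c') \<in> E" for c c' using that by auto
  have same: "(c', c'') \<in> ?M'\<^sup>*" if "c \<in> ?L" "(c, c') \<in> E" "(c, c'') \<in> E" for c c' c''
    using child[OF that(1,2)] child[OF that(1,3)] sib[OF that(2,3)] by blast
  have "(a, b) \<in> ?M\<^sup>*" using Suc.IH[OF a(1) b(1)] .
  \<comment> \<open>Generalised to all children of the end of the chain, so that the induction may
    pass through whichever child the next meeting needs.\<close>
  then have "\<forall>y. (b, y) \<in> E \<longrightarrow> (x, y) \<in> ?M'\<^sup>*"
  proof (induction rule: rtrancl_induct)
    case base
    then show ?case using same[of a x] a by auto
  next
    case (step c d)
    have cd: "c \<in> ?L" "d \<in> ?L" using step.hyps(2) by auto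
    obtain z where z: "(c, z) \<in> E\<^sup>*" "(d, z) \<in> E\<^sup>*" using step.hyps(2) by auto
    have "(x, y) \<in> ?M'\<^sup>*" if dy: "(d, y) \<in> E" for y
    proof (cases "c = d")
      case True
      then show ?thesis using step.IH dy by blast
    next
      case False
      obtain i j where ij: "(c, z) \<in> E ^^ i" "(d, z) \<in> E ^^ j"
        using z rtrancl_imp_relpow by metis
      \<comment> \<open>Disjointness of levels puts \<open>z\<close> equally far below
        \<open>c\<close> and \<open>d\<close>; as these differ, that depth is positive and both
        walks have a first step.\<close>
      have "(u, z) \<in> E ^^ (n + i)" "(u, z) \<in> E ^^ (n + j)"
        using cd ij unfolding relpow_add by blast+
      then have "n + i = n + j" by (rule level_unique[OF u])
      then have "i = j" by simp
      have cdV: "c \<in> V" "d \<in> V" using cd relpow_in u by auto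
      have "i \<noteq> 0"
      proof
        assume "i = 0"
        with ij \<open>i = j\<close> False show False by simp
      qed
      then have "z \<noteq> c" "z \<noteq> d"
        using level_unique[OF cdV(1), of c i 0] level_unique[OF cdV(2), of d i 0] ij \<open>i = j\<close>
        by auto
      with z obtain c1 d1 where 1: "(c, c1) \<in> E" "(c1, z) \<in> E\<^sup>*" "(d, d1) \<in> E" "(d1, z) \<in> E\<^sup>*"
        by (metis converse_rtranclE)
      have "(c1, d1) \<in> ?M'" using 1 cd child by blast
      moreover have "(x, c1) \<in> ?M'\<^sup>*" using step.IH 1(1) by blast
      moreover have "(d1, y) \<in> ?M'\<^sup>*" using same[OF cd(2) 1(3) dy] .
      ultimately show ?thesis by (meson rtrancl.rtrancl_into_rtrancl rtrancl_trans)
    qed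
    then show ?case by blast
  qed
  with b(2) show ?case by blast
qed simp

text \<open>
  If all siblings had a common descendant, every level would be chained together by such meetings;
  at depths where the in-degrees inside \<open>E\<^sup>* `` {u}\<close> have stabilised, a meeting cannot leave the
  descendants of a fixed successor of \<open>u\<close>, so the levels would stop growing.
\<close>

lemma disjoint_siblings_exist:
  assumes "V \<noteq> {}"
  shows "\<exists>p x y. (p, x) \<in> E \<and> (p, y) \<in> E \<and> E\<^sup>* `` {x} \<inter> E\<^sup>* `` {y} = {}"
proof (rule ccontr)
  assume "\<not> ?thesis"
  then have sib: "\<And>p x y. (p, x) \<in> E \<Longrightarrow> (p, y) \<in> E \<Longrightarrow> (x, y) \<in> meet" by blast
  obtain K where K: "K \<ge> 1" "\<And>j. j \<ge> K \<Longrightarrow> level_in_degree j = level_in_degree K"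
    using bounded_mono_nat_stabilises[of level_in_degree m, OF level_in_degree_mono[OF assms]
        level_in_degree_le[OF assms]] by blast
  obtain u w where uw: "u \<in> V" "(u, w) \<in> E" using assms out_nonempty by blast
  then have w: "w \<in> V" using arcs_subset by auto
  let ?L = "(E ^^ Suc K) `` {u}"
  \<comment> \<open>\<open>a\<close> is the start of all chains: it lies below \<open>w\<close>, and
    the property of lying below \<open>w\<close> is passed along each chain.\<close>
  obtain a where a: "(w, a) \<in> E ^^ K" using level_nonempty[OF w] by blast
  then have ua: "(u, a) \<in> E ^^ Suc K" using uw by (auto intro: relpow_Suc_I2 simp del: relpow.simps)
  have "?L \<subseteq> (E ^^ K) `` {w}"
  proof
    fix y assume "y \<in> ?L"
    then have "(a, y) \<in> (meet \<inter> ?L \<times> ?L)\<^sup>*"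
      by (intro level_chain_connected[OF sib uw(1) ua]) auto
    then have "(w, y) \<in> E ^^ K"
    proof (induction rule: rtrancl_induct)
      case (step c d)
      then obtain z where z: "(c, z) \<in> E\<^sup>*" "(d, z) \<in> E\<^sup>*" by auto
      then obtain i j where ij: "(c, z) \<in> E ^^ i" "(d, z) \<in> E ^^ j"
        using rtrancl_imp_relpow by metis
      have cd: "(u, c) \<in> E ^^ Suc K" "(u, d) \<in> E ^^ Suc K" using step.hyps(2) by auto
      have "(u, z) \<in> E ^^ (Suc K + i)" "(u, z) \<in> E ^^ (Suc K + j)"
        using cd ij unfolding relpow_add by blast+
      then have "Suc K + i = Suc K + j" by (rule level_unique[OF uw(1)])
      then have "i = j" by simp
      \<comment> \<open>The meeting point \<open>z\<close> is below \<open>w\<close> because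
        \<open>c\<close> is; going back up from \<open>z\<close> to \<open>d\<close> cannot leave
        the descendants of \<open>w\<close>.\<close>
      moreover have "(w, z) \<in> E ^^ (K + i)"
        using step.IH ij(1) unfolding relpow_add by blast
      ultimately show ?case
        using ancestors_stay_below[OF K(2) uw _ cd(2) ij(2)] by blast
    qed (rule a)
    then show "y \<in> (E ^^ K) `` {w}" by blast
  qed
  then have "card ?L \<le> card ((E ^^ K) `` {w})" using finite_level[OF w] by (intro card_mono)
  \<comment> \<open>By vertex transitivity level \<open>K\<close> below \<open>w\<close> is as large
    as level \<open>K\<close> below \<open>u\<close>, while P3 makes level \<open>K + 1\<close>
    below \<open>u\<close> strictly larger.\<close>
  then show False
    using growth[OF uw(1) K(1)] card_level_eq[OF uw(1) w, of K] by simp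
qed

end

text \<open>\<open>disjoint_pairs_trans\<close> is the form in which weak descendant-homogeneity
  enters: the descendant subdigraphs of any two pairs without common descendants are isomorphic, by
  \<open>disjoint_pair_isom\<close>.\<close>

locale descendant_homogeneous_dag = distance_transitive_dag +
  assumes nonempty: "V \<noteq> {}"
    and undirected_connected: "\<lbrakk>u \<in> V; v \<in> V\<rbrakk> \<Longrightarrow> (u, v) \<in> (E \<union> E\<inverse>)\<^sup>*"
    and disjoint_pairs_trans: "\<lbrakk>x \<in> V; y \<in> V; x' \<in> V; y' \<in> V;
        E\<^sup>* `` {x} \<inter> E\<^sup>* `` {y} = {}; E\<^sup>* `` {x'} \<inter> E\<^sup>* `` {y'} = {}\<rbrakk>
        \<Longrightarrow> \<exists>g. rel_aut V E g \<and> g x = x' \<and> g y = y'"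
begin

section \<open>Consequences of weak descendant-homogeneity\<close>

text \<open>Some siblings \<open>a\<close> and \<open>b\<close> have no common descendant; an
  automorphism moving them to \<open>x\<close> and \<open>y\<close> takes their common predecessor
  \<open>q\<close> to the one required.\<close>

lemma disjoint_common_pred:
  assumes "x \<in> V" "y \<in> V" "E\<^sup>* `` {x} \<inter> E\<^sup>* `` {y} = {}"
  obtains p where "(p, x) \<in> E" "(p, y) \<in> E"
proof -
  obtain q a b where q: "(q, a) \<in> E" "(q, b) \<in> E" "E\<^sup>* `` {a} \<inter> E\<^sup>* `` {b} = {}"
    using disjoint_siblings_exist[OF nonempty] by blast
  then have V: "q \<in> V" "a \<in> V" "b \<in> V" using arcs_subset by auto
  obtain g where g: "rel_aut V E g" "g a = x" "g b = y"
    using disjoint_pairs_trans[OF V(2,3) assms(1,2) q(3) assms(3)] by blast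
  then have "(g q, x) \<in> E" "(g q, y) \<in> E" using q V unfolding rel_aut_def by metis+
  then show ?thesis by (rule that)
qed

text \<open>Vertex transitivity moves a disjoint sibling pair so that one member becomes
  \<open>y\<close>.\<close>

lemma disjoint_partner:
  assumes "y \<in> V"
  obtains x where "x \<in> V" "E\<^sup>* `` {x} \<inter> E\<^sup>* `` {y} = {}"
proof -
  obtain q a b where q: "(q, a) \<in> E" "(q, b) \<in> E" "E\<^sup>* `` {a} \<inter> E\<^sup>* `` {b} = {}"
    using disjoint_siblings_exist[OF nonempty] by blast
  then have V: "a \<in> V" "b \<in> V" using arcs_subset by auto
  obtain g where g: "rel_aut V E g" "g b = y" using vertex_trans[OF V(2) assms] by blast
  have inj: "inj_on g V" using g by (simp add: rel_aut_def bij_betw_def)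
  have sub: "E\<^sup>* `` {c} \<subseteq> V" if "c \<in> V" for c
    using that relpow_in by (auto simp: rtrancl_is_UN_relpow)
  have im: "g ` (E\<^sup>* `` {c}) = E\<^sup>* `` {g c}" if "c \<in> V" for c
    using rel_aut_image_rtrancl[OF arcs_subset g(1) that] by (simp add: bij_betw_def)
  have "E\<^sup>* `` {g a} \<inter> E\<^sup>* `` {y} = g ` (E\<^sup>* `` {a} \<inter> E\<^sup>* `` {b})"
    using inj_on_image_Int[OF inj sub[OF V(1)] sub[OF V(2)]] im V g(2) by simp
  then have "E\<^sup>* `` {g a} \<inter> E\<^sup>* `` {y} = {}" using q(3) by simp
  with rel_aut_in[OF g(1) V(1)] show ?thesis by (rule that)
qed

lemma disjoint_descendant:
  assumes "E\<^sup>* `` {x} \<inter> E\<^sup>* `` {y} = {}" "(y, z) \<in> E\<^sup>*"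
  shows "E\<^sup>* `` {x} \<inter> E\<^sup>* `` {z} = {}"
  using assms by (auto dest: rtrancl_trans)

text \<open>Every descendant of a disjoint partner \<open>y\<close> is an out-neighbour of some
  predecessor of \<open>v\<close>. Finitely many predecessors of finite out-valency could not cover
  that infinite set.\<close>

lemma infinite_in:
  assumes "v \<in> V"
  shows "infinite (E\<inverse> `` {v})"
proof
  assume fin: "finite (E\<inverse> `` {v})"
  obtain y where y: "y \<in> V" "E\<^sup>* `` {v} \<inter> E\<^sup>* `` {y} = {}"
    using disjoint_partner[OF assms] by (metis Int_commute)
  have "E\<^sup>* `` {y} \<subseteq> (\<Union>p\<in>E\<inverse> `` {v}. E `` {p})"
  proof
    fix z assume z: "z \<in> E\<^sup>* `` {y}"
    then have "z \<in> V" using y(1) relpow_in by (auto simp: rtrancl_is_UN_relpow)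
    with z obtain p where "(p, v) \<in> E" "(p, z) \<in> E"
      using disjoint_common_pred[OF assms _ disjoint_descendant[OF y(2)]] by auto
    then show "z \<in> (\<Union>p\<in>E\<inverse> `` {v}. E `` {p})" by auto
  qed
  moreover have "finite (\<Union>p\<in>E\<inverse> `` {v}. E `` {p})"
    using fin finite_out arcs_subset by auto
  ultimately show False using infinite_descendants[OF y(1)] finite_subset by blast
qed

text \<open>A common predecessor forces equal heights, so \<open>x\<close> has the height of
  \<open>y\<close> and also that of its out-neighbour \<open>z\<close>.\<close>

lemma no_height_function:
  fixes f :: "'a \<Rightarrow> int"
  assumes "\<And>u v. (u, v) \<in> E \<Longrightarrow> f v = f u + 1"
  shows False
proof -
  obtain y where y: "y \<in> V" using nonempty by blast
  obtain x where x: "x \<in> V" "E\<^sup>* `` {x} \<inter> E\<^sup>* `` {y} = {}" using disjoint_partner[OF y] .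
  obtain z where z: "(y, z) \<in> E" using out_nonempty[OF y] by blast
  then have zV: "z \<in> V" using arcs_subset by auto
  have "E\<^sup>* `` {x} \<inter> E\<^sup>* `` {z} = {}" using disjoint_descendant[OF x(2)] z by blast
  then obtain p q where "(p, x) \<in> E" "(p, y) \<in> E" "(q, x) \<in> E" "(q, z) \<in> E"
    using disjoint_common_pred[OF x(1) y x(2)] disjoint_common_pred[OF x(1) zV] by metis
  then show False using assms z by (metis add_cancel_right_right zero_neq_one)
qed

text \<open>A symmetric relation whose chains compose freely;
  \<open>adjacent_chain_alternating_walk\<close> later turns a chain into a single alternating
  walk.\<close>

definition adjacent_arcs :: "('a \<times> 'a) rel" where
  "adjacent_arcs = {((a, b), (c, d)). (a, b) \<in> E \<and> (c, d) \<in> E \<and> (a = c \<or> b = d)}"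

lemma adjacent_arcs_rtrancl_sym: "(e, e') \<in> adjacent_arcs\<^sup>* \<Longrightarrow> (e', e) \<in> adjacent_arcs\<^sup>*"
proof -
  have "sym adjacent_arcs" by (auto simp: adjacent_arcs_def sym_def)
  then show "(e, e') \<in> adjacent_arcs\<^sup>* \<Longrightarrow> (e', e) \<in> adjacent_arcs\<^sup>*"
    using sym_rtrancl by (auto dest: symD)
qed

lemma adjacent_arcs_disjoint:
  assumes "E\<^sup>* `` {x} \<inter> E\<^sup>* `` {y} = {}" "(a, x) \<in> E" "(b, y) \<in> E"
  shows "((a, x), (b, y)) \<in> adjacent_arcs\<^sup>*"
proof -
  obtain p where p: "(p, x) \<in> E" "(p, y) \<in> E"
    using disjoint_common_pred[OF _ _ assms(1)] assms(2,3) arcs_subset by blast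
  have "((a, x), (p, x)) \<in> adjacent_arcs" "((p, x), (p, y)) \<in> adjacent_arcs"
    "((p, y), (b, y)) \<in> adjacent_arcs"
    using assms(2,3) p by (auto simp: adjacent_arcs_def)
  then show ?thesis by (meson converse_rtrancl_into_rtrancl rtrancl.rtrancl_refl)
qed

text \<open>A vertex \<open>x\<close> disjoint from \<open>y\<close> is also disjoint from
  \<open>z\<close>, so an arc into \<open>x\<close> is linked to both \<open>(b, y)\<close> and
  \<open>(y, z)\<close>.\<close>

lemma adjacent_arcs_consecutive:
  assumes "(b, y) \<in> E" "(y, z) \<in> E"
  shows "((b, y), (y, z)) \<in> adjacent_arcs\<^sup>*"
proof -
  have y: "y \<in> V" using assms arcs_subset by auto
  obtain x where x: "x \<in> V" "E\<^sup>* `` {x} \<inter> E\<^sup>* `` {y} = {}" using disjoint_partner[OF y] .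
  obtain a where a: "(a, x) \<in> E" using disjoint_common_pred[OF x(1) y x(2)] .
  have "((a, x), (b, y)) \<in> adjacent_arcs\<^sup>*"
    using adjacent_arcs_disjoint[OF x(2) a assms(1)] .
  moreover have "((a, x), (y, z)) \<in> adjacent_arcs\<^sup>*"
    using adjacent_arcs_disjoint[OF disjoint_descendant[OF x(2)] a assms(2)] assms(2) by blast
  ultimately show ?thesis by (meson adjacent_arcs_rtrancl_sym rtrancl_trans)
qed

lemma adjacent_arcs_universal:
  assumes "(a, b) \<in> E" "(c, d) \<in> E"
  shows "((a, b), (c, d)) \<in> adjacent_arcs\<^sup>*"
proof -
  have ac: "a \<in> V" "c \<in> V" using assms arcs_subset by auto
  have tail: "((v, x), (v, y)) \<in> adjacent_arcs\<^sup>*" if "(v, x) \<in> E" "(v, y) \<in> E" for v x y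
    using that by (auto simp: adjacent_arcs_def)
  have next_arc: "((v, x), (w, y)) \<in> adjacent_arcs\<^sup>*"
    if "(v, w) \<in> E" "(v, x) \<in> E" "(w, y) \<in> E" for v w x y
    using tail[OF that(2,1)] adjacent_arcs_consecutive[OF that(1,3)] by (rule rtrancl_trans)
  \<comment> \<open>Induction along an undirected path from \<open>a\<close> to \<open>c\<close>,
    keeping all arcs that leave the current vertex. Symmetry of the chains handles arcs traversed
    backwards.\<close>
  have "\<forall>d. (c, d) \<in> E \<longrightarrow> ((a, b), (c, d)) \<in> adjacent_arcs\<^sup>*"
    using undirected_connected[OF ac]
  proof (induction rule: rtrancl_induct)
    case base
    then show ?case using tail[OF assms(1)] by blast
  next
    case (step v w)
    then have "v \<in> V" using arcs_subset by auto
    then obtain x where x: "(v, x) \<in> E" using out_nonempty by blast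
    have "((v, x), (w, y)) \<in> adjacent_arcs\<^sup>*" if "(w, y) \<in> E" for y
      using step.hyps(2) next_arc[OF _ x that] next_arc[OF _ that x] adjacent_arcs_rtrancl_sym
      by blast
    then show ?case using step.IH x by (meson rtrancl_trans)
  qed
  then show ?thesis using assms(2) by blast
qed

end

section \<open>Alternating walks from chains of arcs\<close>

lemma alternating_walk_extend:
  fixes x :: "nat \<Rightarrow> 'a"
  assumes wf: "parcs D \<subseteq> pverts D \<times> pverts D"
    and v: "\<forall>i\<le>n. x i \<in> pverts D"
    and even: "\<forall>i. 1 \<le> i \<and> 2 * i \<le> n \<longrightarrow> (x (2 * i), x (2 * i - 1)) \<in> parcs D"
    and odd: "\<forall>i. 2 * i + 1 \<le> n \<longrightarrow> (x (2 * i), x (2 * i + 1)) \<in> parcs D"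
    and n: "odd n" and ab: "(a, x n) \<in> parcs D" "(a, b) \<in> parcs D"
  defines "y \<equiv> x(n + 1 := a, n + 2 := b)"
  shows "\<forall>i\<le>n + 2. y i \<in> pverts D"
    and "\<forall>i. 1 \<le> i \<and> 2 * i \<le> n + 2 \<longrightarrow> (y (2 * i), y (2 * i - 1)) \<in> parcs D"
    and "\<forall>i. 2 * i + 1 \<le> n + 2 \<longrightarrow> (y (2 * i), y (2 * i + 1)) \<in> parcs D"
proof -
  \<comment> \<open>As \<open>n\<close> is odd, the walk ends with a forward arc. The new steps are
    \<open>(a, x n)\<close> backwards and \<open>(a, b)\<close> forwards, both belonging to index
    \<open>k + 1\<close>.\<close>
  obtain k where k: "n = 2 * k + 1" using n by (elim oddE)
  show "\<forall>i\<le>n + 2. y i \<in> pverts D"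
    using v ab wf by (auto simp: y_def numeral_2_eq_2 le_Suc_eq)
  show "\<forall>i. 1 \<le> i \<and> 2 * i \<le> n + 2 \<longrightarrow> (y (2 * i), y (2 * i - 1)) \<in> parcs D"
  proof (intro allI impI)
    fix i assume i: "1 \<le> i \<and> 2 * i \<le> n + 2"
    show "(y (2 * i), y (2 * i - 1)) \<in> parcs D"
    proof (cases "i = k + 1")
      case True
      then show ?thesis using ab k by (simp add: y_def)
    next
      case False
      then have "2 * i \<le> n" using i k by auto
      moreover from this have "2 * i - 1 \<noteq> n + 1" "2 * i - 1 \<noteq> n + 2" by linarith+
      ultimately show ?thesis using even i by (simp add: y_def)
    qed
  qed
  show "\<forall>i. 2 * i + 1 \<le> n + 2 \<longrightarrow> (y (2 * i), y (2 * i + 1)) \<in> parcs D"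
  proof (intro allI impI)
    fix i assume i: "2 * i + 1 \<le> n + 2"
    show "(y (2 * i), y (2 * i + 1)) \<in> parcs D"
    proof (cases "i = k + 1")
      case True
      then show ?thesis using ab k by (simp add: y_def)
    next
      case False
      then have "2 * i + 1 \<le> n" using i k by auto
      then show ?thesis using odd by (simp add: y_def)
    qed
  qed
qed

text \<open>Whether \<open>(a, b)\<close> and \<open>(c, d)\<close> share a tail or a head,
  \<open>(c, b)\<close> is an arc, so each link of the chain extends the walk by the two vertices
  \<open>c\<close> and \<open>d\<close>.\<close>

lemma adjacent_chain_alternating_walk:
  fixes D :: "'a pair_pre_digraph"
  assumes wf: "parcs D \<subseteq> pverts D \<times> pverts D"
    and S: "S \<subseteq> {((a, b), (c, d)). (c, b) \<in> parcs D \<and> (c, d) \<in> parcs D}"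
    and "(e, e') \<in> S\<^sup>*" "e \<in> parcs D"
  shows "\<exists>n (x :: nat \<Rightarrow> 'a). odd n \<and> (\<forall>i\<le>n. x i \<in> pverts D) \<and>
      (\<forall>i. 1 \<le> i \<and> 2 * i \<le> n \<longrightarrow> (x (2 * i), x (2 * i - 1)) \<in> parcs D) \<and>
      (\<forall>i. 2 * i + 1 \<le> n \<longrightarrow> (x (2 * i), x (2 * i + 1)) \<in> parcs D) \<and>
      e = (x 0, x 1) \<and> e' = (x (n - 1), x n)"
  using assms(3)
proof (induction rule: rtrancl_induct)
  case base
  obtain a b where e: "e = (a, b)" by (cases e)
  have "a \<in> pverts D" "b \<in> pverts D" using assms(4) wf e by auto
  then show ?case
    using assms(4) e
    by (intro exI[of _ 1] exI[of _ "\<lambda>i::nat. if i = 0 then a else b"]) auto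
next
  case (step f f')
  then obtain n and x :: "nat \<Rightarrow> 'a" where x: "odd n" "\<forall>i\<le>n. x i \<in> pverts D"
    "\<forall>i. 1 \<le> i \<and> 2 * i \<le> n \<longrightarrow> (x (2 * i), x (2 * i - 1)) \<in> parcs D"
    "\<forall>i. 2 * i + 1 \<le> n \<longrightarrow> (x (2 * i), x (2 * i + 1)) \<in> parcs D"
    "e = (x 0, x 1)" "f = (x (n - 1), x n)" by blast
  obtain a b where f': "f' = (a, b)" by (cases f')
  have ab: "(a, x n) \<in> parcs D" "(a, b) \<in> parcs D" using step.hyps(2) S x(6) f' by auto
  have "n \<noteq> 0" using odd_pos[OF x(1)] by simp
  then show ?case
    using alternating_walk_extend[OF wf x(2-4,1) ab] x(1,5) f'
    by (intro exI[of _ "n + 2"] exI[of _ "x(n + 1 := a, n + 2 := b)"]) auto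
qed

section \<open>From the digraph notions to relations\<close>

lemma s_arc_iff_relpow:
  assumes wf: "parcs D \<subseteq> pverts D \<times> pverts D" and "acyclic (parcs D)"
  shows "(\<exists>p. s_arc D s p u v) \<longleftrightarrow> u \<in> pverts D \<and> (u, v) \<in> parcs D ^^ s"
proof
  assume "\<exists>p. s_arc D s p u v"
  then show "u \<in> pverts D \<and> (u, v) \<in> parcs D ^^ s"
    unfolding s_arc_def relpow_fun_conv by auto
next
  assume u: "u \<in> pverts D \<and> (u, v) \<in> parcs D ^^ s"
  then obtain p where p: "p 0 = u" "p s = v" "\<And>i. i < s \<Longrightarrow> (p i, p (Suc i)) \<in> parcs D"
    unfolding relpow_fun_conv by blast
  have "p i \<in> pverts D" if "i \<le> s" for i
  proof (cases i)
    case 0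
    then show ?thesis using u p by simp
  next
    case (Suc j)
    then show ?thesis using p(3)[of j] that wf by auto
  qed
  \<comment> \<open>Stepping back to the vertex before the last would close a directed cycle of
    length two.\<close>
  moreover have "p (i - 1) \<noteq> p (i + 1)" if "0 < i" "i < s" for i
  proof
    assume "p (i - 1) = p (i + 1)"
    moreover have "(p (i - 1), p i) \<in> parcs D" "(p i, p (i + 1)) \<in> parcs D"
      using p(3)[of "i - 1"] p(3)[of i] that by simp_all
    ultimately show False
      using assms(2) by (metis acyclic_def trancl.r_into_trancl trancl.trancl_into_trancl)
  qed
  ultimately show "\<exists>p. s_arc D s p u v" unfolding s_arc_def using p by auto
qed

lemma acyclic_if_no_directed_cycle:
  assumes "\<nexists>n p. directed_cycle D n p"
  shows "acyclic (parcs D)"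
proof (rule acyclicI, rule allI, rule notI)
  fix x assume "(x, x) \<in> (parcs D)\<^sup>+"
  then obtain n where n: "n > 0" "(x, x) \<in> parcs D ^^ n" using trancl_power[of "(x, x)"] by blast
  then obtain p where "p 0 = x" "p n = x" "\<forall>i<n. (p i, p (Suc i)) \<in> parcs D"
    unfolding relpow_fun_conv by blast
  then have "directed_cycle D n p" using n by (simp add: directed_cycle_def)
  with assms show False by blast
qed

lemma digraph_aut_iff_rel_aut: "digraph_aut D g \<longleftrightarrow> rel_aut (pverts D) (parcs D) g"
  by (simp add: digraph_aut_def digraph_isom_def rel_aut_def)

text \<open>Two automorphisms, one for each vertex, are glued. Disjointness makes the result a
  bijection, and no arc joins the two descendant sets, since its head would be a common
  descendant.\<close>

lemma disjoint_pair_isom: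
  fixes D :: "'a pair_pre_digraph"
  defines "E \<equiv> parcs D" and "V \<equiv> pverts D"
  assumes wf: "E \<subseteq> V \<times> V"
    and desc: "\<And>u. u \<in> V \<Longrightarrow> desc D u = E\<^sup>* `` {u}"
    and V: "x \<in> V" "y \<in> V" "x' \<in> V" "y' \<in> V"
    and disj: "E\<^sup>* `` {x} \<inter> E\<^sup>* `` {y} = {}" "E\<^sup>* `` {x'} \<inter> E\<^sup>* `` {y'} = {}"
    and g: "rel_aut V E g" "g x = x'" and h: "rel_aut V E h" "h y = y'"
  defines "f \<equiv> \<lambda>z. if z \<in> E\<^sup>* `` {x} then g z else h z"
  shows "digraph_isom f (with_proj D \<restriction> desc_set D {x, y}) (with_proj D \<restriction> desc_set D {x', y'})"
proof -
  let ?A = "E\<^sup>* `` {x}" and ?B = "E\<^sup>* `` {y}" and ?A' = "E\<^sup>* `` {x'}" and ?B' = "E\<^sup>* `` {y'}"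
  have ds: "desc_set D {x, y} = ?A \<union> ?B" "desc_set D {x', y'} = ?A' \<union> ?B'"
    using desc V by (auto simp: desc_set_def)
  have bA: "bij_betw g ?A ?A'" using rel_aut_image_rtrancl[OF wf g(1) V(1)] g(2) by simp
  have bB: "bij_betw h ?B ?B'" using rel_aut_image_rtrancl[OF wf h(1) V(2)] h(2) by simp
  have fA: "f z = g z" if "z \<in> ?A" for z using that by (simp add: f_def)
  have fB: "f z = h z" if "z \<in> ?B" for z using that disj(1) by (auto simp: f_def)
  have "bij_betw f ?A ?A'" using bA bij_betw_cong[of ?A f g] fA by blast
  moreover have "bij_betw f ?B ?B'" using bB bij_betw_cong[of ?B f h] fB by blast
  ultimately have bij: "bij_betw f (?A \<union> ?B) (?A' \<union> ?B')"
    using disj(2) by (rule bij_betw_combine)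
  have inA: "f z \<in> ?A'" if "z \<in> ?A" for z using that bA fA by (auto simp: bij_betw_def)
  have inB: "f z \<in> ?B'" if "z \<in> ?B" for z using that bB fB by (auto simp: bij_betw_def)
  have sub: "E\<^sup>* `` {c} \<subseteq> V" if "c \<in> V" for c
    using that relpow_in_carrier[OF wf] by (auto simp: rtrancl_is_UN_relpow)
  have closed: "w \<in> E\<^sup>* `` {c}" if "z \<in> E\<^sup>* `` {c}" "(z, w) \<in> E" for z w c
    using that by (auto intro: rtrancl_into_rtrancl)
  have "(u, v) \<in> E \<longleftrightarrow> (f u, f v) \<in> E" if uv: "u \<in> ?A \<union> ?B" "v \<in> ?A \<union> ?B" for u v
  proof -
    consider "u \<in> ?A" "v \<in> ?A" | "u \<in> ?B" "v \<in> ?B" | "u \<in> ?A" "v \<in> ?B" | "u \<in> ?B" "v \<in> ?A"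
      using uv by blast
    then show ?thesis
    proof cases
      case 1
      then show ?thesis using g(1) sub[OF V(1)] fA unfolding rel_aut_def by (metis subsetD)
    next
      case 2
      then show ?thesis using h(1) sub[OF V(2)] fB unfolding rel_aut_def by (metis subsetD)
    next
      case 3
      then show ?thesis using closed[of u x v] closed[of "f u" x' "f v"] inA inB disj by blast
    next
      case 4
      then show ?thesis using closed[of u y v] closed[of "f u" y' "f v"] inA inB disj by blast
    qed
  qed
  moreover have "arcs_ends (with_proj D \<restriction> W) = E \<inter> W \<times> W" for W
    by (auto simp: arcs_ends_conv image_iff E_def)
  moreover have "f u \<in> ?A' \<union> ?B'" if "u \<in> ?A \<union> ?B" for u using that inA inB by blast
  ultimately show ?thesis
    using bij unfolding digraph_isom_def ds by simp
qed

text \<open>Connectedness of a digraph is strong connectedness of its symmetric closure.\<close>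

lemma connected_undirected_rtrancl:
  assumes "Digraph_Component.connected (with_proj D)" "u \<in> pverts D" "v \<in> pverts D"
  shows "(u, v) \<in> (parcs D \<union> (parcs D)\<inverse>)\<^sup>*"
proof -
  have "u \<rightarrow>\<^sup>*\<^bsub>with_proj (mk_symmetric (with_proj D))\<^esub> v"
    using assms by (simp add: connected_def strongly_connected_def)
  then have "(u, v) \<in> (parcs (mk_symmetric (with_proj D)))\<^sup>*"
    by (auto dest: reachable_rtranclI)
  moreover have "parcs (mk_symmetric (with_proj D)) = parcs D \<union> (parcs D)\<inverse>"
    by (auto simp: parcs_mk_symmetric)
  ultimately show ?thesis by simp
qed

theorem theorem4p3:
  fixes D :: "'a pair_pre_digraph" and m :: nat
  assumes "pair_loopfree_digraph D"
    and "infinite (pverts D)"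
    and "Digraph_Component.connected (with_proj D)"
    and "distance_transitive D"
    and "weakly_descendant_homogeneous D"
    and "has_out_valency D m" and "m > 0"
    and "\<nexists>n p. directed_cycle D n p"
    and "descendants_P3 D"
  shows "infinite_in_valency D \<and> reachability_universal D \<and> \<not> property_Z D"
proof -
  let ?V = "pverts D" and ?E = "parcs D"
  interpret pair_loopfree_digraph D by fact
  have wf: "?E \<subseteq> ?V \<times> ?V" using wellformed' by auto
  have acyc: "acyclic ?E" using assms(8) by (rule acyclic_if_no_directed_cycle)
  note arc_iff = s_arc_iff_relpow[OF wf acyc]
  have level: "desc_level D s u = (?E ^^ s) `` {u}" if "u \<in> ?V" for s u
    using that arc_iff by (auto simp: desc_level_def)
  have desc: "desc D u = ?E\<^sup>* `` {u}" if "u \<in> ?V" for u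
    using level[OF that] by (auto simp: desc_def rtrancl_is_UN_relpow)
  \<comment> \<open>Valencies count arcs while the locale counts neighbours; the map between them is
    injective.\<close>
  have out: "out_arcs (with_proj D) u = Pair u ` (?E `` {u})" for u by (auto simp: out_arcs_def)
  have in_eq: "in_arcs (with_proj D) u = (\<lambda>p. (p, u)) ` (?E\<inverse> `` {u})" for u
    by (auto simp: in_arcs_def)
  have vt: "\<exists>g. rel_aut ?V ?E g \<and> g u = v" if "u \<in> ?V" "v \<in> ?V" for u v
    using assms(5) that
    by (auto simp: weakly_descendant_homogeneous_def vertex_transitive_def digraph_aut_iff_rel_aut)
  interpret G: descendant_homogeneous_dag ?V ?E m
  proof
    show "finite (?E `` {u})" "card (?E `` {u}) = m" if "u \<in> ?V" for u
      using assms(6) that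
      by (auto simp: has_out_valency_def out_degree_def out card_image inj_on_def finite_image_iff)
    show "\<exists>g. rel_aut ?V ?E g \<and> g u = u' \<and> g v = v'"
      if "u \<in> ?V" "u' \<in> ?V" "(u, v) \<in> ?E ^^ s" "\<And>t. t < s \<Longrightarrow> (u, v) \<notin> ?E ^^ t"
        "(u', v') \<in> ?E ^^ s" "\<And>t. t < s \<Longrightarrow> (u', v') \<notin> ?E ^^ t" for u u' v v' s
    proof -
      have "at_distance D s u v" "at_distance D s u' v'"
        using that unfolding at_distance_def arc_iff by auto
      then show ?thesis
        using assms(4) unfolding distance_transitive_def digraph_aut_iff_rel_aut by blast
    qed
    show "card ((?E ^^ i) `` {u}) < card ((?E ^^ Suc i) `` {u})" if "u \<in> ?V" "i \<ge> 1" for u i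
    proof -
      have "card (desc_level D i u) < card (desc_level D (i + 1) u)"
        using assms(9) that by (simp add: descendants_P3_def)
      then show ?thesis unfolding level[OF that(1)] by (simp only: Suc_eq_plus1)
    qed
    show "?V \<noteq> {}" using assms(2) by auto
    show "(u, v) \<in> (?E \<union> ?E\<inverse>)\<^sup>*" if "u \<in> ?V" "v \<in> ?V" for u v
      using connected_undirected_rtrancl[OF assms(3) that] .
    show "\<exists>g. rel_aut ?V ?E g \<and> g x = x' \<and> g y = y'"
      if V: "x \<in> ?V" "y \<in> ?V" "x' \<in> ?V" "y' \<in> ?V"
        and disj: "?E\<^sup>* `` {x} \<inter> ?E\<^sup>* `` {y} = {}" "?E\<^sup>* `` {x'} \<inter> ?E\<^sup>* `` {y'} = {}"
      for x y x' y'
    proof -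
      obtain g h where g: "rel_aut ?V ?E g" "g x = x'" and h: "rel_aut ?V ?E h" "h y = y'"
        using vt V by metis
      define f where "f = (\<lambda>z. if z \<in> ?E\<^sup>* `` {x} then g z else h z)"
      have "digraph_isom f (with_proj D \<restriction> desc_set D {x, y}) (with_proj D \<restriction> desc_set D {x', y'})"
        unfolding f_def by (rule disjoint_pair_isom[OF wf desc V disj g h])
      \<comment> \<open>The glued map is only an isomorphism of descendant subdigraphs; weak
        descendant-homogeneity replaces it by an automorphism of \<open>D\<close> agreeing with it
        on \<open>x\<close> and \<open>y\<close>.\<close>
      then obtain k where k: "digraph_aut D k" "\<forall>z\<in>{x, y}. k z = f z"
        using assms(5) V unfolding weakly_descendant_homogeneous_def
        by (metis empty_subsetI finite.emptyI finite.insertI insert_subset)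
      have "f x = x'" "f y = y'" using g h disj(1) by (auto simp: f_def)
      with k show ?thesis by (auto simp: digraph_aut_iff_rel_aut)
    qed
  qed (use wf acyc vt assms(7) in auto)
  have "infinite_in_valency D"
    using G.infinite_in by (auto simp: infinite_in_valency_def in_eq inj_on_def finite_image_iff)
  moreover have "\<not> property_Z D"
    using G.no_height_function unfolding property_Z_def by fast
  moreover have "edge_reachability D = ?E \<times> ?E"
  proof
    show "edge_reachability D \<subseteq> ?E \<times> ?E" by (auto simp: edge_reachability_def)
    show "?E \<times> ?E \<subseteq> edge_reachability D"
    proof clarify
      fix a b c d assume e: "(a, b) \<in> ?E" "(c, d) \<in> ?E"
      have "G.adjacent_arcs \<subseteq> {((a, b), (c, d)). (c, b) \<in> ?E \<and> (c, d) \<in> ?E}"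
        by (auto simp: G.adjacent_arcs_def)
      from adjacent_chain_alternating_walk[OF wf this G.adjacent_arcs_universal[OF e] e(1)]
      obtain n and x :: "nat \<Rightarrow> 'a" where x: "odd n" "\<forall>i\<le>n. x i \<in> ?V"
        "\<forall>i. 1 \<le> i \<and> 2 * i \<le> n \<longrightarrow> (x (2 * i), x (2 * i - 1)) \<in> ?E"
        "\<forall>i. 2 * i + 1 \<le> n \<longrightarrow> (x (2 * i), x (2 * i + 1)) \<in> ?E"
        "(a, b) = (x 0, x 1)" "(c, d) = (x (n - 1), x n)" by blast
      \<comment> \<open>The walk leaves along a forward arc, so it has the second of the two
        alternating forms.\<close>
      have "alternating_walk D n x" unfolding alternating_walk_def using x(2-4) by blast
      moreover have "n \<ge> 1" using x(1) by (cases n) auto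
      ultimately show "((a, b), (c, d)) \<in> edge_reachability D"
        unfolding edge_reachability_def using e x(5,6) by blast
    qed
  qed
  \<comment> \<open>There is exactly one class because the arc set is nonempty.\<close>
  moreover have "?E // (?E \<times> ?E) = {?E}"
    using G.nonempty G.out_nonempty by (fastforce simp: quotient_def)
  ultimately show ?thesis by (simp add: reachability_universal_def)
qed

end
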